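(* Let $(S,* )$ be a commutative adequate partial semigroup, let $A\subseteq S$, and let $k\in\mathbb{N}$. The following are equivalent. (1) For every $L\in\mathcal{P}_f(S)$ there exists $r\in\mathbb{N}$ such that for every $F\in\mathcal{P}_f(\mathcal{T})_{\leq k}$ there exist $b\in S$ and $H\in\mathcal{P}_f(\{1,\dots,r\})$ such that for all $f\in F$, $b*\prod_{t\in H}f(t)$ is defined and lies in $A\cap\sigma(L)$. (2) For every $L\in\mathcal{P}_f(S)$ there exists $r\in\mathbb{N}$ such that for every $F\in\mathcal{P}_f(\mathcal{T})_{\leq k}$ there exist $m\in\mathbb{N}$, $a\in S^{m+1}$ and $t(1)<\dots<t(m)\leq r$ in $\mathbb{N}$ such that for all $f\in F$, $a(1)*f(t(1))*a(2)*\dots*a(m)*f(t(m))*a(m+1)$ is defined and lies in $A\cap\sigma(L)$.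
   Context: A partial semigroup is a pair $(S,* )$ where $S$ is a nonempty set and $*$ is an operation defined on a nonempty subset of $S\times S$ such that for all $x,y,z\in S$, $(x*y)*z=x*(y*z)$ in the sense that if either side is defined then so is the other and they are equal; it is commutative if for all $x,y$, $x*y$ is defined iff $y*x$ is defined, and then $x*y=y*x$. For $a\in S$, $\varphi(a)=\{b\in S: a*b \text{ is defined}\}$; for finite nonempty $F\subseteq S$, $\sigma(F)=\bigcap_{a\in F}\varphi(a)$. $(S,* )$ is adequate if $\sigma(F)\neq\emptyset$ for all finite nonempty $F$. $\mathcal{P}_f(X)$ denotes the set of finite nonempty subsets of $X$. Products $\prod_{t\in H}f(t)$ are computed in increasing order of indices. A sequence $f:\mathbb{N}\to S$ is adequate if (i) for each $H\in\mathcal{P}_f(\mathbb{N})$, $\prod_{t\in H}f(t)$ is defined, and (ii) for each $F\in\mathcal{P}_f(S)$ there is $m\in\mathbb{N}$ such that $\prod_{t\in H}f(t)\in\sigma(F)$ for all $H\in\mathcal{P}_f(\mathbb{N})$ with $\min H\geq m$. $\mathcal{T}$ denotes the set of adequate sequences, and $\mathcal{P}_f(\mathcal{T})_{\leq k}=\{F\in\mathcal{P}_f(\mathcal{T}): |F|\leq k\}$. *)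

theory Defs
  imports Complex_Main "HOL-Library.FuncSet"
begin

text \<open>
  A partial operation on a carrier \<open>S\<close> is a function \<open>p :: 'a \<Rightarrow> 'a \<Rightarrow> 'a option\<close>;
  \<open>p x y = None\<close> means that the product of \<open>x\<close> and \<open>y\<close> is undefined, and it is undefined
  whenever \<open>x\<close> or \<open>y\<close> lies outside \<open>S\<close>.  Equality of the two optional values
  in the associativity and commutativity laws says: if one side is defined, then so is the
  other and they agree.  The set of natural numbers is \<open>{1..}\<close>.
\<close>

definition partial_semigroup :: "'a set \<Rightarrow> ('a \<Rightarrow> 'a \<Rightarrow> 'a option) \<Rightarrow> bool" where
  "partial_semigroup S p \<longleftrightarrow>
     S \<noteq> {} \<and>
     (\<forall>x y z. p x y = Some z \<longrightarrow> x \<in> S \<and> y \<in> S \<and> z \<in> S) \<and>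
     (\<exists>x y. p x y \<noteq> None) \<and>
     (\<forall>x\<in>S. \<forall>y\<in>S. \<forall>z\<in>S.
        Option.bind (p x y) (\<lambda>u. p u z) = Option.bind (p y z) (\<lambda>v. p x v))"

definition commutative_on :: "'a set \<Rightarrow> ('a \<Rightarrow> 'a \<Rightarrow> 'a option) \<Rightarrow> bool" where
  "commutative_on S p \<longleftrightarrow> (\<forall>x\<in>S. \<forall>y\<in>S. p x y = p y x)"

definition Pf :: "'a set \<Rightarrow> 'a set set" where
  "Pf X = {F. finite F \<and> F \<noteq> {} \<and> F \<subseteq> X}"

definition Pf_le :: "'a set \<Rightarrow> nat \<Rightarrow> 'a set set" where
  "Pf_le X k = {F \<in> Pf X. card F \<le> k}"

definition phi :: "'a set \<Rightarrow> ('a \<Rightarrow> 'a \<Rightarrow> 'a option) \<Rightarrow> 'a \<Rightarrow> 'a set" where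
  "phi S p a = {b \<in> S. p a b \<noteq> None}"

definition sigma :: "'a set \<Rightarrow> ('a \<Rightarrow> 'a \<Rightarrow> 'a option) \<Rightarrow> 'a set \<Rightarrow> 'a set" where
  "sigma S p F = (\<Inter>a\<in>F. phi S p a)"

definition adequate :: "'a set \<Rightarrow> ('a \<Rightarrow> 'a \<Rightarrow> 'a option) \<Rightarrow> bool" where
  "adequate S p \<longleftrightarrow> (\<forall>F\<in>Pf S. sigma S p F \<noteq> {})"

text \<open>
  The product of a nonempty list, bracketed to the right; in a partial semigroup the
  bracketing does not matter (lemma \<open>list_product_append\<close>).  The empty product is undefined.
\<close>

fun list_product :: "('a \<Rightarrow> 'a \<Rightarrow> 'a option) \<Rightarrow> 'a list \<Rightarrow> 'a option" where
  "list_product p [] = None"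
| "list_product p [x] = Some x"
| "list_product p (x # y # zs) = Option.bind (list_product p (y # zs)) (p x)"

lemma list_product_Cons:
  "ys \<noteq> [] \<Longrightarrow> list_product p (x # ys) = Option.bind (list_product p ys) (p x)"
  by (cases ys) auto

lemma list_product_in_carrier:
  assumes "partial_semigroup S p" "set xs \<subseteq> S" "list_product p xs = Some w"
  shows "w \<in> S"
proof (cases xs)
  case (Cons x ys)
  show ?thesis
  proof (cases "ys = []")
    case True
    then show ?thesis using assms Cons by simp
  next
    case False
    then show ?thesis
      using assms Cons by (auto simp: list_product_Cons partial_semigroup_def bind_eq_Some_conv)
  qed
qed (use assms in simp)

lemma list_product_append:
  assumes "partial_semigroup S p" "set xs \<subseteq> S" "set ys \<subseteq> S" "xs \<noteq> []" "ys \<noteq> []"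
  shows "list_product p (xs @ ys) =
    Option.bind (list_product p xs) (\<lambda>u. Option.bind (list_product p ys) (p u))"
  using assms(2,4)
proof (induction xs)
  case (Cons x xs)
  show ?case
  proof (cases "xs = []")
    case True
    then show ?thesis using assms(5) by (simp add: list_product_Cons)
  next
    case False
    have assoc: "Option.bind (p x u) (\<lambda>w. p w v) = Option.bind (p u v) (p x)"
      if "u \<in> S" "v \<in> S" for u v
      using assms(1) that Cons.prems unfolding partial_semigroup_def by simp
    show ?thesis
    proof (cases "list_product p xs")
      case None
      then show ?thesis using Cons False by (simp add: list_product_Cons)
    next
      case u: (Some u)
      then have "u \<in> S" using list_product_in_carrier[OF assms(1) _ u] Cons.prems by simp
      show ?thesis
      proof (cases "list_product p ys")
        case None
        then show ?thesis using u Cons False by (cases "p x u") (simp_all add: list_product_Cons)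
      next
        case v: (Some v)
        then have "v \<in> S" using list_product_in_carrier[OF assms(1,3)] by simp
        then show ?thesis using u v Cons False assoc[OF \<open>u \<in> S\<close>] by (simp add: list_product_Cons)
      qed
    qed
  qed
qed simp

definition seq_product ::
    "('a \<Rightarrow> 'a \<Rightarrow> 'a option) \<Rightarrow> (nat \<Rightarrow> 'a) \<Rightarrow> nat set \<Rightarrow> 'a option" where
  "seq_product p f H = list_product p (map f (sorted_list_of_set H))"

text \<open>
  Sequences are extensional functions on \<open>{1..}\<close>, so that two of them are equal iff they have
  the same terms; this matters when counting the elements of a set of sequences.
\<close>

definition adequate_sequences :: "'a set \<Rightarrow> ('a \<Rightarrow> 'a \<Rightarrow> 'a option) \<Rightarrow> (nat \<Rightarrow> 'a) set" where
  "adequate_sequences S p = {f \<in> {1..} \<rightarrow>\<^sub>E S.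
     (\<forall>H\<in>Pf {1..}. seq_product p f H \<noteq> None) \<and>
     (\<forall>F\<in>Pf S. \<exists>m\<ge>1. \<forall>H\<in>Pf {1..}. Min H \<ge> m \<longrightarrow>
        (\<exists>w\<in>sigma S p F. seq_product p f H = Some w))}"

text \<open>The product \<open>a(1) * f(t(1)) * a(2) * \<dots> * a(m) * f(t(m)) * a(m + 1)\<close>.\<close>

definition interleaved_product ::
    "('a \<Rightarrow> 'a \<Rightarrow> 'a option) \<Rightarrow> nat \<Rightarrow> (nat \<Rightarrow> 'a) \<Rightarrow> (nat \<Rightarrow> nat) \<Rightarrow> (nat \<Rightarrow> 'a) \<Rightarrow> 'a option" where
  "interleaved_product p m a t f =
     list_product p (concat (map (\<lambda>i. [a i, f (t i)]) [1..<m + 1]) @ [a (m + 1)])"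

end

theory Submission
  imports Defs "HOL-Library.Multiset"
begin

text \<open>
  In a commutative partial semigroup whether a product is defined, and its value, depend only on
  the multiset of factors, so (2) gives (1) by collecting the \<open>a(i)\<close> into \<open>b\<close>.  For the converse
  let \<open>r\<close> be the bound from (1).  Far terms of a member \<open>h\<close> of \<open>F\<close> can be
  multiplied with all products of \<open>f \<in> F\<close> over subsets of \<open>{1..r}\<close>; so with \<open>c(n) = h(s + n)\<close>, \<open>s\<close>
  large, every product of \<open>f(n) * c(n)\<close>, \<open>n \<le> r\<close>, is defined.  Continuing by a late tail
  of \<open>f\<close> gives an adequate sequence, and (1) applied to these sequences gives (2) with \<open>a(1) = b\<close>
  and \<open>a(i + 1) = c(t(i))\<close>.
\<close>

section \<open>Reordering the factors of a product\<close>

locale comm_partial_semigroup =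
  fixes S :: "'a set" and p :: "'a \<Rightarrow> 'a \<Rightarrow> 'a option"
  assumes semigroup: "partial_semigroup S p" and comm: "commutative_on S p"
begin

lemma closed: "p x y = Some z \<Longrightarrow> z \<in> S"
  using semigroup unfolding partial_semigroup_def by blast

text \<open>If further factors follow, associativity groups the first two into one factor and
  commutativity applies to that pair. The equality is one of optional values, so it covers undefined
  products as well.\<close>

lemma list_product_swap:
  assumes "x \<in> S" "y \<in> S" "set zs \<subseteq> S"
  shows "list_product p (x # y # zs) = list_product p (y # x # zs)"
proof (cases "zs = []")
  case True
  then show ?thesis using assms comm by (simp add: commutative_on_def)
next
  case False
  have "p x y = p y x" using assms comm by (simp add: commutative_on_def)
  then show ?thesis
    using list_product_append[OF semigroup, of "[x, y]" zs]
      list_product_append[OF semigroup, of "[y, x]" zs] assms False by simp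
qed

lemma list_product_move:
  assumes "x \<in> S" "set us \<subseteq> S" "set vs \<subseteq> S"
  shows "list_product p (us @ x # vs) = list_product p (x # us @ vs)"
  using assms(2)
proof (induction us)
  case (Cons u us)
  have "list_product p ((u # us) @ x # vs) = Option.bind (list_product p (us @ x # vs)) (p u)"
    by (simp add: list_product_Cons)
  also have "\<dots> = list_product p (u # x # us @ vs)"
    using Cons by (simp add: list_product_Cons)
  also have "\<dots> = list_product p (x # u # us @ vs)"
    using Cons assms by (intro list_product_swap) auto
  finally show ?case by simp
qed simp

text \<open>The head of \<open>xs\<close> occurs somewhere in \<open>ys\<close>; moving it to the
  front there leaves tails with equal multisets. All later uses of commutativity go through this
  lemma.\<close>

lemma list_product_mset_eq:
  assumes "mset xs = mset ys" "set xs \<subseteq> S"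
  shows "list_product p xs = list_product p ys"
  using assms
proof (induction xs arbitrary: ys)
  case (Cons x xs)
  have "x \<in> set ys" using Cons.prems(1) by (metis list.set_intros(1) set_mset_mset)
  then obtain us vs where ys: "ys = us @ x # vs" by (meson split_list)
  have xs: "mset xs = mset (us @ vs)" using Cons.prems(1) ys by simp
  then have sets: "set xs = set (us @ vs)" by (metis set_mset_mset)
  have "list_product p ys = list_product p (x # us @ vs)"
    unfolding ys using Cons.prems(2) sets by (intro list_product_move) auto
  also have "\<dots> = list_product p (x # xs)"
  proof (cases "xs = []")
    case False
    then have "us @ vs \<noteq> []" using sets by auto
    then show ?thesis
      using False Cons.IH[OF xs] Cons.prems(2) by (simp add: list_product_Cons)
  qed (use sets in auto)
  finally show ?case by simp
qed simp

section \<open>Products over finite index sets\<close>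

lemma mset_sorted_list_of_set: "mset (sorted_list_of_set H) = mset_set H"
  by (metis mset_sorted_list_of_multiset sorted_list_of_mset_set)

lemma seq_product_eq_list:
  assumes "f ` H \<subseteq> S" "finite H" "mset xs = image_mset f (mset_set H)"
  shows "seq_product p f H = list_product p xs"
  unfolding seq_product_def using assms
  by (intro list_product_mset_eq) (auto simp: mset_sorted_list_of_set)

lemma seq_product_closed:
  assumes "f ` H \<subseteq> S" "finite H" "seq_product p f H = Some w"
  shows "w \<in> S"
  using assms(1,2)
  by (intro list_product_in_carrier[OF semigroup _ assms(3)[unfolded seq_product_def]]) auto

text \<open>Sorting the union may mix the two index sets. Commutativity separates them again, so
  disjointness is enough, and associativity then splits the concatenated list.\<close>

lemma seq_product_Un:
  assumes "finite H" "finite K" "H \<noteq> {}" "K \<noteq> {}" "H \<inter> K = {}" "f ` (H \<union> K) \<subseteq> S"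
  shows "seq_product p f (H \<union> K) =
    Option.bind (seq_product p f H) (\<lambda>u. Option.bind (seq_product p f K) (p u))"
proof -
  let ?l = "\<lambda>H. map f (sorted_list_of_set H)"
  have "seq_product p f (H \<union> K) = list_product p (?l H @ ?l K)"
    using assms by (intro seq_product_eq_list) (auto simp: mset_sorted_list_of_set mset_set_Union)
  also have "\<dots> = Option.bind (seq_product p f H) (\<lambda>u. Option.bind (seq_product p f K) (p u))"
    unfolding seq_product_def using assms
    by (intro list_product_append[OF semigroup]) auto
  finally show ?thesis .
qed

lemma seq_product_shift:
  assumes "finite H" "f ` ((+) s ` H) \<subseteq> S"
  shows "seq_product p (\<lambda>n. f (s + n)) H = seq_product p f ((+) s ` H)"
proof -
  have "seq_product p f ((+) s ` H) = list_product p (map (\<lambda>n. f (s + n)) (sorted_list_of_set H))"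
    using assms
    by (intro seq_product_eq_list)
      (auto simp: mset_sorted_list_of_set image_mset_mset_set[symmetric] multiset.map_comp comp_def)
  then show ?thesis by (simp add: seq_product_def)
qed

section \<open>Interleaved lists and termwise products\<close>

lemma mset_interleave:
  "mset (concat (map (\<lambda>i. [u i, v i]) xs)) = mset (map u xs) + mset (map v xs)"
  by (induction xs) auto

lemma set_interleave: "set (concat (map (\<lambda>i. [u i, v i]) xs)) = u ` set xs \<union> v ` set xs"
  by auto

text \<open>Associativity alone collapses each adjacent pair \<open>f n\<close>, \<open>c n\<close>
  into the factor \<open>g n\<close>, also when the whole product is undefined.\<close>

lemma list_product_pairwise:
  assumes "\<And>n. n \<in> set xs \<Longrightarrow> f n \<in> S \<and> c n \<in> S \<and> p (f n) (c n) = Some (g n)"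
  shows "list_product p (map g xs) = list_product p (concat (map (\<lambda>n. [f n, c n]) xs))"
  using assms
proof (induction xs)
  case (Cons x xs)
  show ?case
  proof (cases "xs = []")
    case False
    have "set (concat (map (\<lambda>n. [f n, c n]) xs)) \<subseteq> S"
      using Cons.prems by (subst set_interleave) auto
    then have "list_product p ([f x, c x] @ concat (map (\<lambda>n. [f n, c n]) xs)) =
      Option.bind (list_product p [f x, c x])
        (\<lambda>u. Option.bind (list_product p (concat (map (\<lambda>n. [f n, c n]) xs))) (p u))"
      using Cons.prems False by (intro list_product_append[OF semigroup]) auto
    then show ?thesis using Cons False by (simp add: list_product_Cons)
  qed (use Cons in simp)
qed simp

text \<open>Collects the factors from \<open>f\<close> and those from \<open>c\<close>. The right
  side stays a single list, so that it can either be split in two or receive a further factor in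
  front.\<close>

lemma seq_product_pairwise:
  assumes "finite H" "\<And>n. n \<in> H \<Longrightarrow> f n \<in> S \<and> c n \<in> S \<and> p (f n) (c n) = Some (g n)"
  shows "seq_product p g H = list_product p
    (map f (sorted_list_of_set H) @ map c (sorted_list_of_set H))"
proof -
  let ?xs = "sorted_list_of_set H"
  have "seq_product p g H = list_product p (concat (map (\<lambda>n. [f n, c n]) ?xs))"
    unfolding seq_product_def using assms by (intro list_product_pairwise) auto
  also have "\<dots> = list_product p (map f ?xs @ map c ?xs)"
    using assms by (intro list_product_mset_eq) (simp_all add: mset_interleave set_interleave, auto)
  finally show ?thesis .
qed

text \<open>A strictly increasing \<open>t\<close> is injective, so the image of \<open>t\<close>
  counts each factor \<open>f (t i)\<close> exactly once and both sides have the same multiset of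
  factors.\<close>

lemma interleaved_product_eq:
  assumes "strict_mono_on {1..m} t" "\<And>i. i \<in> {1..m + 1} \<Longrightarrow> a i \<in> S"
    and "\<And>i. i \<in> {1..m} \<Longrightarrow> f (t i) \<in> S"
  shows "interleaved_product p m a t f =
    list_product p (map a [1..<m + 2] @ map f (sorted_list_of_set (t ` {1..m})))"
proof -
  have "inj_on t {1..m}" using assms(1) by (rule strict_mono_on_imp_inj_on)
  then have "mset_set (t ` {1..m}) = image_mset t (mset_set {1..m})"
    by (simp add: image_mset_mset_set)
  moreover have "mset_set {1..m} = mset [1..<m + 1]"
    using mset_sorted_list_of_set[of "{1..<m + 1}"]
    by (simp add: atLeastLessThanSuc_atLeastAtMost del: upt_Suc)
  ultimately have t: "mset (map f (sorted_list_of_set (t ` {1..m}))) =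
      mset (map (\<lambda>i. f (t i)) [1..<m + 1])"
    by (simp add: mset_sorted_list_of_set multiset.map_comp comp_def)
  have a: "mset (map a [1..<m + 2]) = mset (map a [1..<m + 1]) + {#a (m + 1)#}" by simp
  show ?thesis
    unfolding interleaved_product_def
  proof (rule list_product_mset_eq)
    show "mset (concat (map (\<lambda>i. [a i, f (t i)]) [1..<m + 1]) @ [a (m + 1)]) =
      mset (map a [1..<m + 2] @ map f (sorted_list_of_set (t ` {1..m})))"
      unfolding mset_append mset_interleave t a by simp
    show "set (concat (map (\<lambda>i. [a i, f (t i)]) [1..<m + 1]) @ [a (m + 1)]) \<subseteq> S"
      unfolding set_append set_interleave using assms by auto
  qed
qed

section \<open>Prolonging and multiplying adequate sequences\<close>

lemma finite_partial_products:
  assumes "\<And>f. f \<in> F \<Longrightarrow> f ` {1..r} \<subseteq> S" "finite F"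
  defines "X \<equiv> {w. \<exists>f\<in>F. \<exists>H\<in>Pf {1..r::nat}. seq_product p f H = Some w}"
  shows "finite X" "X \<subseteq> S"
proof -
  \<comment> \<open>Only finitely many pairs of a sequence and an index set occur. An undefined
    product contributes the value \<open>the None\<close>, which merely enlarges the finite
    superset.\<close>
  have "X \<subseteq> (\<lambda>(f, H). the (seq_product p f H)) ` (F \<times> Pow {1..r})"
  proof
    fix w assume "w \<in> X"
    then obtain f H where "f \<in> F" "H \<in> Pf {1..r}" "seq_product p f H = Some w"
      unfolding X_def by blast
    then show "w \<in> (\<lambda>(f, H). the (seq_product p f H)) ` (F \<times> Pow {1..r})"
      by (intro image_eqI[of _ _ "(f, H)"]) (auto simp: Pf_def)
  qed
  then show "finite X" by (rule finite_subset) (use assms(2) in auto)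
  show "X \<subseteq> S"
  proof
    fix w assume "w \<in> X"
    then obtain f H where "f \<in> F" "H \<in> Pf {1..r}" "seq_product p f H = Some w"
      unfolding X_def by auto
    then show "w \<in> S"
      using assms(1)[of f] by (intro seq_product_closed[of f H]) (auto simp: Pf_def)
  qed
qed

text \<open>
  The prolongation follows \<open>f\<close>, shifted so far that its products can be multiplied with the
  finitely many products of \<open>g\<close>.
\<close>

lemma prolong_to_adequate_sequence:
  assumes f: "f \<in> adequate_sequences S p" and "r \<ge> 1" and g: "g ` {1..r} \<subseteq> S"
    and defd: "\<And>H. H \<in> Pf {1..r} \<Longrightarrow> seq_product p g H \<noteq> None"
  shows "\<exists>g'\<in>adequate_sequences S p. \<forall>n\<in>{1..r}. g' n = g n"
proof -
  \<comment> \<open>Condition (ii) of adequacy speaks about finite nonempty subsets of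
    \<open>S\<close>. The bound \<open>r\<close> makes the set of products of \<open>g\<close>
    finite, and \<open>r \<ge> 1\<close> gives it an element.\<close>
  define X where "X = {w. \<exists>f\<in>{g}. \<exists>H\<in>Pf {1..r}. seq_product p f H = Some w}"
  have "finite X" "X \<subseteq> S"
    unfolding X_def by (rule finite_partial_products; use g in simp)+
  moreover have "{1} \<in> Pf {1..r}" using \<open>r \<ge> 1\<close> by (simp add: Pf_def)
  then have "X \<noteq> {}" unfolding X_def using defd by blast
  ultimately have "X \<in> Pf S" by (simp add: Pf_def)
  with f obtain M where M: "\<And>H. H \<in> Pf {1..} \<Longrightarrow> Min H \<ge> M \<Longrightarrow>
      \<exists>w\<in>sigma S p X. seq_product p f H = Some w"
    unfolding adequate_sequences_def by blast
  have fS: "f n \<in> S" if "n \<ge> 1" for n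
    using f that unfolding adequate_sequences_def by auto
  \<comment> \<open>The tail reads \<open>f\<close> at \<open>M + n\<close>, beyond the point from
    which the products of \<open>f\<close> lie in \<open>sigma S p X\<close>;
    \<open>restrict\<close> makes the sequence extensional.\<close>
  define g' where "g' = restrict (\<lambda>n. if n \<le> r then g n else f (M + n)) {1..}"
  have g'S: "g' n \<in> S" if "n \<ge> 1" for n
    using that g fS by (auto simp: g'_def)
  have head: "seq_product p g' H = seq_product p g H" if "H \<subseteq> {1..r}" for H
  proof -
    have "finite H" using that finite_subset by blast
    then show ?thesis
      unfolding seq_product_def using that
      by (intro arg_cong[where f = "list_product p"] map_cong) (auto simp: g'_def subset_iff)
  qed
  have tail: "seq_product p g' H = seq_product p f ((+) M ` H)"
    if "finite H" "H \<subseteq> {r<..}" for H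
  proof -
    have "seq_product p g' H = seq_product p (\<lambda>n. f (M + n)) H"
      unfolding seq_product_def using that
      by (intro arg_cong[where f = "list_product p"] map_cong) (auto simp: g'_def subset_iff)
    also have "\<dots> = seq_product p f ((+) M ` H)"
      using that fS by (intro seq_product_shift) auto
    finally show ?thesis .
  qed
  have shift: "(+) M ` H \<in> Pf {1..}" "Min ((+) M ` H) \<ge> M" "Min ((+) M ` H) \<ge> Min H"
    if "H \<in> Pf {1..}" for H
  proof -
    have "finite H" "H \<noteq> {}" using that by (auto simp: Pf_def)
    then have "Min ((+) M ` H) = M + Min H"
      by (intro mono_Min_commute[symmetric]) (auto simp: mono_def)
    then show "Min ((+) M ` H) \<ge> M" "Min ((+) M ` H) \<ge> Min H" by auto
    show "(+) M ` H \<in> Pf {1..}" using that by (auto simp: Pf_def)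
  qed
  have "seq_product p g' H \<noteq> None" if H: "H \<in> Pf {1..}" for H
  proof -
    \<comment> \<open>Cutting the index set at \<open>r\<close> puts the head product in
      \<open>X\<close> and the tail product in \<open>sigma S p X\<close>, so the two can be
      multiplied.\<close>
    define H1 where "H1 = H \<inter> {..r}"
    define H2 where "H2 = H \<inter> {r<..}"
    have HH: "H = H1 \<union> H2" "H1 \<inter> H2 = {}" by (auto simp: H1_def H2_def)
    have fin: "finite H1" "finite H2" using H by (auto simp: Pf_def H1_def H2_def)
    have sub: "H1 \<subseteq> {1..r}" "H2 \<subseteq> {r<..}" "H2 \<subseteq> {1..}"
      using H by (auto simp: Pf_def H1_def H2_def)
    have s1: "\<exists>w\<in>X. seq_product p g' H1 = Some w" if "H1 \<noteq> {}"
    proof -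
      have "H1 \<in> Pf {1..r}" using that fin sub by (simp add: Pf_def)
      then show ?thesis using defd[of H1] head[OF sub(1)] unfolding X_def by fastforce
    qed
    have s2: "\<exists>w\<in>sigma S p X. seq_product p g' H2 = Some w" if "H2 \<noteq> {}"
    proof -
      have "H2 \<in> Pf {1..}" using that fin sub by (simp add: Pf_def)
      then show ?thesis using M[OF shift(1,2)] tail[OF fin(2) sub(2)] by simp
    qed
    show ?thesis
    proof (cases "H1 = {} \<or> H2 = {}")
      case True
      moreover have "H \<noteq> {}" using H by (simp add: Pf_def)
      ultimately show ?thesis using HH(1) s1 s2 by (metis Un_empty_left Un_empty_right option.distinct(1))
    next
      case False
      with s1 s2 obtain u v where "u \<in> X" "v \<in> sigma S p X"
        and uv: "seq_product p g' H1 = Some u" "seq_product p g' H2 = Some v" by blast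
      then have "p u v \<noteq> None" by (auto simp: sigma_def phi_def)
      moreover have "seq_product p g' (H1 \<union> H2) =
        Option.bind (seq_product p g' H1) (\<lambda>u. Option.bind (seq_product p g' H2) (p u))"
      proof (rule seq_product_Un[OF fin _ _ HH(2)])
        have "H1 \<union> H2 \<subseteq> {1..}" using sub by auto
        then show "g' ` (H1 \<union> H2) \<subseteq> S" using g'S by auto
      qed (use False in auto)
      ultimately show ?thesis using uv HH(1) by simp
    qed
  qed
  moreover have "\<exists>m\<ge>1. \<forall>H\<in>Pf {1..}. Min H \<ge> m \<longrightarrow>
      (\<exists>w\<in>sigma S p L. seq_product p g' H = Some w)" if L: "L \<in> Pf S" for L
  proof -
    obtain m where m: "\<And>H. H \<in> Pf {1..} \<Longrightarrow> Min H \<ge> m \<Longrightarrow>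
        \<exists>w\<in>sigma S p L. seq_product p f H = Some w"
      using f L unfolding adequate_sequences_def by blast
    \<comment> \<open>From \<open>m + r + 1\<close> on only the tail of \<open>g'\<close> occurs,
      and the shift by \<open>M\<close> keeps the indices at which \<open>f\<close> is read at least
      \<open>m\<close>. The bound is also positive, as the definition demands.\<close>
    have "\<exists>w\<in>sigma S p L. seq_product p g' H = Some w"
      if H: "H \<in> Pf {1..}" "Min H \<ge> m + r + 1" for H
    proof -
      have "finite H" using H(1) by (simp add: Pf_def)
      moreover have "H \<subseteq> {r<..}"
        using H(2) Min_le[OF \<open>finite H\<close>] by fastforce
      moreover have "Min ((+) M ` H) \<ge> m" using shift(3)[OF H(1)] H(2) by simp
      ultimately show ?thesis using m[OF shift(1)[OF H(1)]] tail by simp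
    qed
    then show ?thesis by (intro exI[of _ "m + r + 1"]) auto
  qed
  moreover have "g' \<in> {1..} \<rightarrow>\<^sub>E S" using g'S by (auto simp: g'_def)
  ultimately have "g' \<in> adequate_sequences S p" unfolding adequate_sequences_def by blast
  moreover have "\<forall>n\<in>{1..r}. g' n = g n" by (simp add: g'_def)
  ultimately show ?thesis by blast
qed

text \<open>One \<open>c\<close> has to serve every \<open>f\<close> in \<open>F\<close>, because
  the factors \<open>a(i)\<close> in (2) do not depend on \<open>f\<close>. Agreement of
  \<open>\<Phi> f\<close> with the termwise product is asked only on \<open>{1..r}\<close>, which
  contains the index sets supplied by (1).\<close>

lemma adequate_sequences_multiplier:
  assumes F: "F \<in> Pf (adequate_sequences S p)" and "r \<ge> 1"
  obtains c \<Phi> where "\<And>n. c n \<in> S"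
    and "\<And>f. f \<in> F \<Longrightarrow> \<Phi> f \<in> adequate_sequences S p"
    and "\<And>f n. f \<in> F \<Longrightarrow> n \<in> {1..r} \<Longrightarrow> p (f n) (c n) = Some (\<Phi> f n)"
proof -
  have fin: "finite F" using F by (simp add: Pf_def)
  \<comment> \<open>Any member of the nonempty set \<open>F\<close> can supply the
    multipliers.\<close>
  obtain h where h: "h \<in> F" "h \<in> adequate_sequences S p" using F by (auto simp: Pf_def)
  have FS: "f n \<in> S" if "f \<in> F" "n \<ge> 1" for f n
    using F that unfolding adequate_sequences_def Pf_def by auto
  have Fdef: "\<exists>w. seq_product p f H = Some w" if "f \<in> F" "H \<in> Pf {1..}" for f H
    using F that unfolding adequate_sequences_def Pf_def[of "{f \<in> _. _ f}"] by auto
  have Pfr: "H \<in> Pf {1..}" if "H \<in> Pf {1..r}" for H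
    using that by (auto simp: Pf_def)
  define X where "X = {w. \<exists>f\<in>F. \<exists>H\<in>Pf {1..r}. seq_product p f H = Some w}"
  have "finite X" "X \<subseteq> S"
    unfolding X_def by (rule finite_partial_products; use FS fin in auto)+
  moreover have one: "{1} \<in> Pf {1..r}" using \<open>r \<ge> 1\<close> by (simp add: Pf_def)
  then have "X \<noteq> {}" unfolding X_def using Fdef[OF h(1) Pfr[OF one]] h(1) by blast
  ultimately have "X \<in> Pf S" by (simp add: Pf_def)
  with h(2) obtain s where s: "s \<ge> 1" "\<And>H. H \<in> Pf {1..} \<Longrightarrow> Min H \<ge> s \<Longrightarrow>
      \<exists>w\<in>sigma S p X. seq_product p h H = Some w"
    unfolding adequate_sequences_def by blast
  \<comment> \<open>Since \<open>s \<ge> 1\<close>, even \<open>c 0\<close> is a term of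
    \<open>h\<close>, so every value of \<open>c\<close> lies in \<open>S\<close>.\<close>
  define c where "c n = h (s + n)" for n
  have cS: "c n \<in> S" for n unfolding c_def using FS[OF h(1)] s(1) by simp
  have cprod: "\<exists>w\<in>sigma S p X. seq_product p c H = Some w" if H: "H \<in> Pf {1..r}" for H
  proof -
    have "(+) s ` H \<in> Pf {1..}" "Min ((+) s ` H) \<ge> s" using H by (auto simp: Pf_def)
    moreover have "seq_product p c H = seq_product p h ((+) s ` H)"
      unfolding c_def[abs_def] using H FS[OF h(1)] by (intro seq_product_shift) (auto simp: Pf_def)
    ultimately show ?thesis using s(2) by metis
  qed
  have fc: "\<exists>w. p u v = Some w"
    if "f \<in> F" "H \<in> Pf {1..r}" "seq_product p f H = Some u" "seq_product p c H = Some v"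
    for f H u v
  proof -
    have "u \<in> X" unfolding X_def using that by blast
    moreover have "v \<in> sigma S p X" using cprod[OF that(2)] that(4) by auto
    ultimately show ?thesis by (auto simp: sigma_def phi_def)
  qed
  have ex: "\<exists>g\<in>adequate_sequences S p. \<forall>n\<in>{1..r}. p (f n) (c n) = Some (g n)"
    if f: "f \<in> F" for f
  proof -
    \<comment> \<open>On \<open>{1..r}\<close> the product is defined, by \<open>fc\<close> for
      singletons. Elsewhere \<open>the\<close> may give an unspecified value, but the prolongation
      keeps only the terms in \<open>{1..r}\<close>.\<close>
    define g where "g n = the (p (f n) (c n))" for n
    have g: "p (f n) (c n) = Some (g n)" if "n \<in> {1..r}" for n
    proof -
      have "{n} \<in> Pf {1..r}" using that by (simp add: Pf_def)
      then have "\<exists>w. p (f n) (c n) = Some w" using fc[OF f] by (simp add: seq_product_def)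
      then show ?thesis by (auto simp: g_def)
    qed
    \<comment> \<open>Regrouping turns the product of \<open>g\<close> into the product of
      \<open>f\<close> times the product of \<open>c\<close> over the same \<open>H\<close>. The
      former lies in \<open>X\<close> and the latter in \<open>sigma S p X\<close>.\<close>
    have "seq_product p g H \<noteq> None" if H: "H \<in> Pf {1..r}" for H
    proof -
      let ?xs = "sorted_list_of_set H"
      have HH: "finite H" "H \<noteq> {}" "H \<subseteq> {1..r}" using H by (auto simp: Pf_def)
      have "seq_product p g H = list_product p (map f ?xs @ map c ?xs)"
        using HH g FS[OF f] cS by (intro seq_product_pairwise) auto
      also have "\<dots> = Option.bind (seq_product p f H) (\<lambda>u. Option.bind (seq_product p c H) (p u))"
        unfolding seq_product_def using HH FS[OF f] cS
        by (intro list_product_append[OF semigroup]) auto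
      finally show ?thesis using fc[OF f H] Fdef[OF f Pfr[OF H]] cprod[OF H] by force
    qed
    moreover have "g ` {1..r} \<subseteq> S" using g closed by blast
    moreover have "f \<in> adequate_sequences S p" using f F by (auto simp: Pf_def)
    ultimately obtain g' where "g' \<in> adequate_sequences S p" "\<forall>n\<in>{1..r}. g' n = g n"
      using prolong_to_adequate_sequence \<open>r \<ge> 1\<close> by metis
    then show ?thesis using g by (intro bexI[of _ g']) auto
  qed
  then obtain \<Phi> where "\<And>f. f \<in> F \<Longrightarrow> \<Phi> f \<in> adequate_sequences S p \<and>
      (\<forall>n\<in>{1..r}. p (f n) (c n) = Some (\<Phi> f n))"
    by metis
  with cS show thesis by (intro that[of c \<Phi>]) auto
qed

section \<open>Translating between the two forms of product\<close>

lemma collect_interleaved_product: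
  assumes "strict_mono_on {1..m} t" "m \<ge> 1" "\<And>i. i \<in> {1..m + 1} \<Longrightarrow> a i \<in> S"
    and "\<And>i. i \<in> {1..m} \<Longrightarrow> f (t i) \<in> S"
  shows "interleaved_product p m a t f =
    Option.bind (list_product p (map a [1..<m + 2]))
      (\<lambda>b. Option.bind (seq_product p f (t ` {1..m})) (p b))"
proof -
  have "interleaved_product p m a t f =
    list_product p (map a [1..<m + 2] @ map f (sorted_list_of_set (t ` {1..m})))"
    using assms by (intro interleaved_product_eq)
  also have "\<dots> = Option.bind (list_product p (map a [1..<m + 2]))
      (\<lambda>b. Option.bind (seq_product p f (t ` {1..m})) (p b))"
    unfolding seq_product_def using assms
    by (intro list_product_append[OF semigroup]) (auto simp del: upt_Suc)
  finally show ?thesis .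
qed

text \<open>The choice of \<open>m\<close>, \<open>a\<close> and \<open>t\<close> depends only on
  \<open>H\<close>, \<open>b\<close> and \<open>c\<close>. The sequences \<open>f\<close> and
  \<open>g\<close> are quantified inside the last conclusion, so that one choice serves all members
  of \<open>F\<close>.\<close>

lemma spread_product:
  assumes "H \<in> Pf {1..r}" "b \<in> S" "\<And>n. c n \<in> S"
  obtains m a t where "m \<ge> 1" "a \<in> {1..m + 1} \<rightarrow>\<^sub>E S" "t \<in> {1..m} \<rightarrow>\<^sub>E {1..}"
    "strict_mono_on {1..m} t" "t m \<le> r"
    "\<And>f g. (\<And>n. n \<in> H \<Longrightarrow> f n \<in> S \<and> p (f n) (c n) = Some (g n)) \<Longrightarrow>
       interleaved_product p m a t f = Option.bind (seq_product p g H) (p b)"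
proof -
  define xs where "xs = sorted_list_of_set H"
  have H: "finite H" "H \<noteq> {}" "H \<subseteq> {1..r}" using assms(1) by (auto simp: Pf_def)
  \<comment> \<open>\<open>t\<close> enumerates \<open>H\<close> increasingly; \<open>i - 1\<close>
    converts from positions \<open>1..m\<close> to list positions starting at 0. The factor
    \<open>b\<close> takes the first slot and \<open>c (t i)\<close> the slot right after
    \<open>f (t i)\<close>.\<close>
  define m where "m = length xs"
  define t where "t = restrict (\<lambda>i. xs ! (i - 1)) {1..m}"
  define a where "a = restrict (\<lambda>i. if i = 1 then b else c (t (i - 1))) {1..m + 1}"
  have set: "set xs = H" using H by (simp add: xs_def)
  then have m: "m \<ge> 1" using H by (cases xs) (auto simp: m_def)
  have tH: "t i \<in> H" if "i \<in> {1..m}" for i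
    using that set by (auto simp: t_def m_def)
  have mono: "strict_mono_on {1..m} t"
  proof (rule strict_mono_onI)
    fix i j assume "i \<in> {1..m}" "j \<in> {1..m}" "i < j"
    then show "t i < t j"
      using sorted_wrt_nth_less[of "(<)" xs "i - 1" "j - 1"] by (auto simp: t_def m_def xs_def)
  qed
  have map_t: "map t [1..<m + 1] = xs"
    by (rule nth_equalityI) (auto simp: t_def m_def simp del: upt_Suc)
  have "t ` {1..m} = set (map t [1..<m + 1])"
    by (simp only: set_map set_upt Suc_eq_plus1[symmetric] atLeastLessThanSuc_atLeastAtMost)
  then have "t ` {1..m} = H" unfolding map_t set .
  \<comment> \<open>Splitting off \<open>a 1 = b\<close> leaves the slots from 2 on, and reindexing
    them by \<open>Suc\<close> cancels the \<open>i - 1\<close> in the definition of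
    \<open>a\<close>.\<close>
  have "[1..<m + 2] = 1 # map Suc [1..<m + 1]"
    by (simp add: map_Suc_upt upt_conv_Cons del: upt_Suc)
  then have "map a [1..<m + 2] = b # map (\<lambda>i. c (t i)) [1..<m + 1]"
    by (auto simp: a_def simp del: upt_Suc)
  also have "map (\<lambda>i. c (t i)) [1..<m + 1] = map c xs"
    unfolding map_t[symmetric] by simp
  finally have map_a: "map a [1..<m + 2] = b # map c xs" .
  have aS: "a \<in> {1..m + 1} \<rightarrow>\<^sub>E S"
    using assms by (auto simp: a_def)
  show thesis
  proof
    show "m \<ge> 1" "a \<in> {1..m + 1} \<rightarrow>\<^sub>E S" "strict_mono_on {1..m} t" by fact+
    have "t \<in> extensional {1..m}" by (simp add: t_def)
    moreover have "t i \<in> {1..}" if "i \<in> {1..m}" for i using tH[OF that] H(3) by auto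
    ultimately show "t \<in> {1..m} \<rightarrow>\<^sub>E {1..}" by (simp add: PiE_def)
    show "t m \<le> r" using tH[of m] m H(3) by auto
    fix f g assume fg: "\<And>n. n \<in> H \<Longrightarrow> f n \<in> S \<and> p (f n) (c n) = Some (g n)"
    have "interleaved_product p m a t f = list_product p (map a [1..<m + 2] @ map f xs)"
      unfolding xs_def \<open>t ` {1..m} = H\<close>[symmetric]
      using PiE_mem[OF aS] fg tH by (intro interleaved_product_eq[OF mono]) auto
    \<comment> \<open>The factors from \<open>c\<close> move behind those from \<open>f\<close>, the
      order in which \<open>seq_product_pairwise\<close> delivers them.\<close>
    also have "\<dots> = list_product p (b # map f xs @ map c xs)"
      unfolding map_a using assms fg set by (intro list_product_mset_eq) auto
    also have "\<dots> = Option.bind (list_product p (map f xs @ map c xs)) (p b)"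
      using m by (intro list_product_Cons) (auto simp: m_def)
    also have "list_product p (map f xs @ map c xs) = seq_product p g H"
      unfolding xs_def using H fg assms by (intro seq_product_pairwise[symmetric]) auto
    finally show "interleaved_product p m a t f = Option.bind (seq_product p g H) (p b)" .
  qed
qed

end

section \<open>Equivalence of conditions (1) and (2)\<close>

theorem theorem5p3:
  fixes S A :: "'a set" and p :: "'a \<Rightarrow> 'a \<Rightarrow> 'a option" and k :: nat
  assumes "partial_semigroup S p" and "commutative_on S p" and "adequate S p"
    and "A \<subseteq> S" and "k \<ge> 1"
  shows
    "(\<forall>L\<in>Pf S. \<exists>r\<ge>1. \<forall>F\<in>Pf_le (adequate_sequences S p) k.
        \<exists>b\<in>S. \<exists>H\<in>Pf {1..r}. \<forall>f\<in>F.
          \<exists>w\<in>A \<inter> sigma S p L. Option.bind (seq_product p f H) (p b) = Some w)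
     \<longleftrightarrow>
     (\<forall>L\<in>Pf S. \<exists>r\<ge>1. \<forall>F\<in>Pf_le (adequate_sequences S p) k.
        \<exists>m\<ge>1. \<exists>a \<in> {1..m + 1} \<rightarrow>\<^sub>E S. \<exists>t \<in> {1..m} \<rightarrow>\<^sub>E {1..}.
          strict_mono_on {1..m} t \<and> t m \<le> r \<and>
          (\<forall>f\<in>F. \<exists>w\<in>A \<inter> sigma S p L. interleaved_product p m a t f = Some w))"
proof (intro iffI ballI)
  interpret comm_partial_semigroup S p using assms by unfold_locales
  fix L assume one: "\<forall>L\<in>Pf S. \<exists>r\<ge>1. \<forall>F\<in>Pf_le (adequate_sequences S p) k.
        \<exists>b\<in>S. \<exists>H\<in>Pf {1..r}. \<forall>f\<in>F.
          \<exists>w\<in>A \<inter> sigma S p L. Option.bind (seq_product p f H) (p b) = Some w"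
    and "L \<in> Pf S"
  then obtain r where r: "r \<ge> 1" "\<And>F. F \<in> Pf_le (adequate_sequences S p) k \<Longrightarrow>
        \<exists>b\<in>S. \<exists>H\<in>Pf {1..r}. \<forall>f\<in>F.
          \<exists>w\<in>A \<inter> sigma S p L. Option.bind (seq_product p f H) (p b) = Some w" by meson
  show "\<exists>r\<ge>1. \<forall>F\<in>Pf_le (adequate_sequences S p) k.
        \<exists>m\<ge>1. \<exists>a \<in> {1..m + 1} \<rightarrow>\<^sub>E S. \<exists>t \<in> {1..m} \<rightarrow>\<^sub>E {1..}.
          strict_mono_on {1..m} t \<and> t m \<le> r \<and>
          (\<forall>f\<in>F. \<exists>w\<in>A \<inter> sigma S p L. interleaved_product p m a t f = Some w)"
  \<comment> \<open>The bound from (1) is kept: it is fixed before \<open>F\<close>, so (1) may be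
    applied to the modified sequences \<open>\<Phi> f\<close> with the same
    \<open>r\<close>.\<close>
  proof (rule exI[of _ r], rule conjI[OF r(1)], rule ballI)
    fix F assume F: "F \<in> Pf_le (adequate_sequences S p) k"
    then have "F \<in> Pf (adequate_sequences S p)" by (simp add: Pf_le_def)
    then obtain c \<Phi> where c: "\<And>n. c n \<in> S"
      and \<Phi>: "\<And>f. f \<in> F \<Longrightarrow> \<Phi> f \<in> adequate_sequences S p"
        "\<And>f n. f \<in> F \<Longrightarrow> n \<in> {1..r} \<Longrightarrow> p (f n) (c n) = Some (\<Phi> f n)"
      using adequate_sequences_multiplier r(1) by blast
    \<comment> \<open>Distinct sequences may have the same image under \<open>\<Phi>\<close>; this
      only lowers the cardinality, so the bound \<open>k\<close> persists.\<close>
    have "\<Phi> ` F \<in> Pf_le (adequate_sequences S p) k"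
      using F \<Phi>(1) card_image_le[of F \<Phi>] by (auto simp: Pf_le_def Pf_def)
    from r(2)[OF this] obtain b H where b: "b \<in> S" and H: "H \<in> Pf {1..r}"
      and w: "\<And>f. f \<in> F \<Longrightarrow> \<exists>w\<in>A \<inter> sigma S p L.
        Option.bind (seq_product p (\<Phi> f) H) (p b) = Some w"
      by blast
    from H b c obtain m a t where mat: "m \<ge> 1" "a \<in> {1..m + 1} \<rightarrow>\<^sub>E S" "t \<in> {1..m} \<rightarrow>\<^sub>E {1..}"
        "strict_mono_on {1..m} t" "t m \<le> r"
      and eq: "\<And>f g. (\<And>n. n \<in> H \<Longrightarrow> f n \<in> S \<and> p (f n) (c n) = Some (g n)) \<Longrightarrow>
        interleaved_product p m a t f = Option.bind (seq_product p g H) (p b)"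
      using spread_product[of H r b c] by blast
    have "\<exists>w\<in>A \<inter> sigma S p L. interleaved_product p m a t f = Some w" if f: "f \<in> F" for f
    proof -
      have "f n \<in> S" if "n \<ge> 1" for n
        using F f that unfolding Pf_le_def Pf_def adequate_sequences_def by auto
      then have "f n \<in> S \<and> p (f n) (c n) = Some (\<Phi> f n)" if "n \<in> H" for n
        using \<Phi>(2)[OF f] H that by (auto simp: Pf_def)
      then show ?thesis using eq w[OF f] by metis
    qed
    then show "\<exists>m\<ge>1. \<exists>a \<in> {1..m + 1} \<rightarrow>\<^sub>E S. \<exists>t \<in> {1..m} \<rightarrow>\<^sub>E {1..}.
          strict_mono_on {1..m} t \<and> t m \<le> r \<and>
          (\<forall>f\<in>F. \<exists>w\<in>A \<inter> sigma S p L. interleaved_product p m a t f = Some w)"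
      using mat by blast
  qed
next
  interpret comm_partial_semigroup S p using assms by unfold_locales
  fix L assume two: "\<forall>L\<in>Pf S. \<exists>r\<ge>1. \<forall>F\<in>Pf_le (adequate_sequences S p) k.
        \<exists>m\<ge>1. \<exists>a \<in> {1..m + 1} \<rightarrow>\<^sub>E S. \<exists>t \<in> {1..m} \<rightarrow>\<^sub>E {1..}.
          strict_mono_on {1..m} t \<and> t m \<le> r \<and>
          (\<forall>f\<in>F. \<exists>w\<in>A \<inter> sigma S p L. interleaved_product p m a t f = Some w)"
    and "L \<in> Pf S"
  then obtain r where r: "r \<ge> 1" "\<And>F. F \<in> Pf_le (adequate_sequences S p) k \<Longrightarrow>
        \<exists>m\<ge>1. \<exists>a \<in> {1..m + 1} \<rightarrow>\<^sub>E S. \<exists>t \<in> {1..m} \<rightarrow>\<^sub>E {1..}.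
          strict_mono_on {1..m} t \<and> t m \<le> r \<and>
          (\<forall>f\<in>F. \<exists>w\<in>A \<inter> sigma S p L. interleaved_product p m a t f = Some w)" by meson
  show "\<exists>r\<ge>1. \<forall>F\<in>Pf_le (adequate_sequences S p) k.
        \<exists>b\<in>S. \<exists>H\<in>Pf {1..r}. \<forall>f\<in>F.
          \<exists>w\<in>A \<inter> sigma S p L. Option.bind (seq_product p f H) (p b) = Some w"
  proof (rule exI[of _ r], rule conjI[OF r(1)], rule ballI)
    fix F assume F: "F \<in> Pf_le (adequate_sequences S p) k"
    from r(2)[OF F] obtain m a t where mat: "m \<ge> 1" "a \<in> {1..m + 1} \<rightarrow>\<^sub>E S"
        "t \<in> {1..m} \<rightarrow>\<^sub>E {1..}" "strict_mono_on {1..m} t" "t m \<le> r"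
      and w: "\<And>f. f \<in> F \<Longrightarrow> \<exists>w\<in>A \<inter> sigma S p L. interleaved_product p m a t f = Some w"
      by blast
    have FS: "f n \<in> S" if "f \<in> F" "n \<ge> 1" for f n
      using F that unfolding Pf_le_def Pf_def adequate_sequences_def by auto
    have eq: "interleaved_product p m a t f =
      Option.bind (list_product p (map a [1..<m + 2]))
        (\<lambda>b. Option.bind (seq_product p f (t ` {1..m})) (p b))" if "f \<in> F" for f
      proof (rule collect_interleaved_product[OF mat(4,1)])
      show "a i \<in> S" if "i \<in> {1..m + 1}" for i
        using PiE_mem[OF mat(2) that] .
      show "f (t i) \<in> S" if "i \<in> {1..m}" for i
        using PiE_mem[OF mat(3) that] FS[OF \<open>f \<in> F\<close>] by simp
    qed
    \<comment> \<open>The product of the \<open>a(i)\<close> does not involve \<open>f\<close>. That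
      it is defined is read off from a single member of \<open>F\<close>, and its value
      \<open>b\<close> then serves for all of them.\<close>
    obtain f0 where f0: "f0 \<in> F" using F by (auto simp: Pf_le_def Pf_def)
    obtain b where b: "list_product p (map a [1..<m + 2]) = Some b"
      using w[OF f0] unfolding eq[OF f0] by (auto simp: bind_eq_Some_conv simp del: upt_Suc)
    have "b \<in> S"
      using mat(2) by (intro list_product_in_carrier[OF semigroup _ b]) (auto simp del: upt_Suc)
    moreover have "t ` {1..m} \<in> Pf {1..r}"
    proof -
      \<comment> \<open>Monotonicity extends the bound on the last index \<open>t m\<close> to the
        whole image of \<open>t\<close>.\<close>
      have "t i \<le> t m" if "i \<in> {1..m}" for i
        using that mat(1,4) strict_mono_on_leD[of "{1..m}" t i m] by auto
      then have "t i \<le> r" if "i \<in> {1..m}" for i using that mat(5) le_trans by blast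
      then show ?thesis using mat(1) PiE_mem[OF mat(3)] by (auto simp: Pf_def)
    qed
    moreover have "\<exists>w\<in>A \<inter> sigma S p L.
        Option.bind (seq_product p f (t ` {1..m})) (p b) = Some w" if "f \<in> F" for f
      using w[OF that] unfolding eq[OF that] b by simp
    ultimately show "\<exists>b\<in>S. \<exists>H\<in>Pf {1..r}. \<forall>f\<in>F.
          \<exists>w\<in>A \<inter> sigma S p L. Option.bind (seq_product p f H) (p b) = Some w"
      by blast
  qed
qed

end
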